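(* Let $\alpha_1,\alpha_2\in[0,1]$ with $\alpha_1+\alpha_2=1$, let $m,c\in\mathbb{R}$, let $U:\mathbb{R}\to\mathbb{R}$ be of class $C^2$, and let $$L\left(t,x,\dot{x},\mathcal{D}^{\alpha_1}_{a+}x,\left(\mathcal{D}^{\alpha_2}_{a+}x\right)^*\right)=\frac12 m\dot{x}^2-U(x)+\frac12 c\left(\mathcal{D}^{\alpha_1}_{a+}x\right)\cdot\left(\mathcal{D}^{\alpha_2}_{a+}x\right)^* .$$ Then, for $x\in C^1([a,b];\mathbb{R})$, the equation $$\partial_2 L-\frac{d}{dt}\left(\partial_3 L\right)-\left(\mathcal{D}^{\alpha_1}_{a+}\left(\partial_4 L\right)^*\right)^*-\left(\mathcal{D}^{\alpha_2}_{a+}\left(\partial_5 L\right)\right)^*=0$$ is equivalent to the equation of motion $$U'(x)+c\,(\dot{x})^*+m\ddot{x}=0 .$$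
   Context: For $f:[a,b]\to\mathbb{R}$ the dual function is $f^*(t)=f(b-t+a)$, $t\in[a,b]$. For $0<\alpha<1$ the left Riemann--Liouville fractional derivative is $(\mathcal{D}^{\alpha}_{a+}\varphi)(t)=\frac{1}{\Gamma(1-\alpha)}\frac{d}{dt}\int_a^t\varphi(\tau)(t-\tau)^{-\alpha}d\tau$; also $\mathcal{D}^0_{a+}\varphi=\varphi$ and $\mathcal{D}^1_{a+}\varphi=\varphi'$. Dots denote derivatives with respect to $t$. $L$ is regarded as a function of five real arguments (the five slots displayed), $\partial_i L$ is its partial derivative with respect to the $i$-th argument, and in the equation $\partial_i L$ denotes the function of $t$ obtained by evaluating it at $\left(t,x(t),\dot{x}(t),(\mathcal{D}^{\alpha_1}_{a+}x)(t),(\mathcal{D}^{\alpha_2}_{a+}x)^*(t)\right)$. *)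

theory Defs
  imports "HOL-Analysis.Analysis"
begin

(* Functions on [a,b] are total functions real => real of which only the values on
   {a..b} matter; accordingly d/dt is the derivative within {a..b}
   (one-sided at the two end points). *)

definition dt :: "real \<Rightarrow> real \<Rightarrow> (real \<Rightarrow> real) \<Rightarrow> real \<Rightarrow> real" where
  "dt a b f t = vector_derivative f (at t within {a..b})"

definition C1_on :: "real \<Rightarrow> real \<Rightarrow> (real \<Rightarrow> real) \<Rightarrow> bool" where
  "C1_on a b f \<longleftrightarrow> (\<forall>t\<in>{a..b}. f differentiable (at t within {a..b})) \<and> continuous_on {a..b} (dt a b f)"

definition C2_UNIV :: "(real \<Rightarrow> real) \<Rightarrow> bool" where
  "C2_UNIV U \<longleftrightarrow> U C1_differentiable_on UNIV \<and> deriv U C1_differentiable_on UNIV"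

definition dual :: "real \<Rightarrow> real \<Rightarrow> (real \<Rightarrow> real) \<Rightarrow> real \<Rightarrow> real" where
  "dual a b f t = f (b - t + a)"

(* The value of the kernel at the single point tau = t (where powr gives 0) is immaterial. *)
definition RL_kernel_integral :: "real \<Rightarrow> real \<Rightarrow> (real \<Rightarrow> real) \<Rightarrow> real \<Rightarrow> real" where
  "RL_kernel_integral a \<alpha> \<phi> t = (LINT \<tau>:{a..t}|lebesgue. \<phi> \<tau> * (t - \<tau>) powr (- \<alpha>))"

definition RL_deriv :: "real \<Rightarrow> real \<Rightarrow> real \<Rightarrow> (real \<Rightarrow> real) \<Rightarrow> real \<Rightarrow> real" where
  "RL_deriv a b \<alpha> \<phi> t =
     (if \<alpha> = 0 then \<phi> t
      else if \<alpha> = 1 then dt a b \<phi> t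
      else 1 / Gamma (1 - \<alpha>) * dt a b (RL_kernel_integral a \<alpha> \<phi>) t)"

(* RL_deriv is total; this predicate says that its value at t is a genuine derivative
   of convergent integrals. *)
definition RL_differentiable :: "real \<Rightarrow> real \<Rightarrow> real \<Rightarrow> (real \<Rightarrow> real) \<Rightarrow> real \<Rightarrow> bool" where
  "RL_differentiable a b \<alpha> \<phi> t \<longleftrightarrow>
     (if \<alpha> = 0 then True
      else if \<alpha> = 1 then \<phi> differentiable (at t within {a..b})
      else (\<forall>s\<in>{a..b}. set_integrable lebesgue {a..s} (\<lambda>\<tau>. \<phi> \<tau> * (s - \<tau>) powr (- \<alpha>)))
           \<and> RL_kernel_integral a \<alpha> \<phi> differentiable (at t within {a..b}))"

type_synonym lagrangian = "real \<Rightarrow> real \<Rightarrow> real \<Rightarrow> real \<Rightarrow> real \<Rightarrow> real"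

definition partial2 :: "lagrangian \<Rightarrow> lagrangian" where
  "partial2 L t y v p q = deriv (\<lambda>z. L t z v p q) y"

definition partial3 :: "lagrangian \<Rightarrow> lagrangian" where
  "partial3 L t y v p q = deriv (\<lambda>z. L t y z p q) v"

definition partial4 :: "lagrangian \<Rightarrow> lagrangian" where
  "partial4 L t y v p q = deriv (\<lambda>z. L t y v z q) p"

definition partial5 :: "lagrangian \<Rightarrow> lagrangian" where
  "partial5 L t y v p q = deriv (\<lambda>z. L t y v p z) q"

definition along :: "real \<Rightarrow> real \<Rightarrow> real \<Rightarrow> real \<Rightarrow> (real \<Rightarrow> real) \<Rightarrow> lagrangian \<Rightarrow> real \<Rightarrow> real" where
  "along a b \<alpha>1 \<alpha>2 x F t =
     F t (x t) (dt a b x t) (RL_deriv a b \<alpha>1 x t) (dual a b (RL_deriv a b \<alpha>2 x) t)"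

(* "The equation holds at t" means that every derivative occurring in it exists and
   that the identity is true. The point b - t + a appears where a starred function
   is evaluated at t. *)
definition EL_equation_at ::
  "real \<Rightarrow> real \<Rightarrow> real \<Rightarrow> real \<Rightarrow> lagrangian \<Rightarrow> (real \<Rightarrow> real) \<Rightarrow> real \<Rightarrow> bool" where
  "EL_equation_at a b \<alpha>1 \<alpha>2 L x t \<longleftrightarrow>
     (let ev = along a b \<alpha>1 \<alpha>2 x in
        x differentiable (at t within {a..b}) \<and>
        RL_differentiable a b \<alpha>1 x t \<and>
        RL_differentiable a b \<alpha>2 x (b - t + a) \<and>
        ev (partial3 L) differentiable (at t within {a..b}) \<and>
        RL_differentiable a b \<alpha>1 (dual a b (ev (partial4 L))) (b - t + a) \<and>
        RL_differentiable a b \<alpha>2 (ev (partial5 L)) (b - t + a) \<and>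
        ev (partial2 L) t
          - dt a b (ev (partial3 L)) t
          - dual a b (RL_deriv a b \<alpha>1 (dual a b (ev (partial4 L)))) t
          - dual a b (RL_deriv a b \<alpha>2 (ev (partial5 L))) t = 0)"

(* For m = 0 the second-order term is absent from the equation, so the existence of the
   second derivative of x is demanded only when m is nonzero. *)
definition motion_equation_at ::
  "real \<Rightarrow> real \<Rightarrow> real \<Rightarrow> real \<Rightarrow> (real \<Rightarrow> real) \<Rightarrow> (real \<Rightarrow> real) \<Rightarrow> real \<Rightarrow> bool" where
  "motion_equation_at a b m c U x t \<longleftrightarrow>
     (m \<noteq> 0 \<longrightarrow> dt a b x differentiable (at t within {a..b})) \<and>
     deriv U (x t) + c * dual a b (dt a b x) t + m * dt a b (dt a b x) t = 0"

end

(* Here d_2 L = - U'(x), d_3 L = m x', d_4 L = c/2 (D^alpha2 x)^* and d_5 L = c/2 D^alpha1 x, so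
   that the claim reduces to D^alpha1 (D^alpha2 x) = D^alpha2 (D^alpha1 x) = x' on (a,b).
   Write J_p g (t) for the integral of g(tau) (t - tau)^(-p) over (a,t). Fubini and the Beta
   integral give J_q (J_p g) = B(1-p, 1-q) J_(p+q-1) g. As x = x(a) + J_0 x', the case {p,q} = {0,alpha}
   shows J_alpha (J_0 x') = J_0 (J_alpha x'), whence D^alpha x is
   (x(a) (t-a)^(-alpha) + J_alpha x') / Gamma(1-alpha); the case p + q = 1 then
   turns J_(1-alpha) (D^alpha x) into Gamma(alpha) x, whose derivative is Gamma(alpha) x'. *)

theory Submission
  imports Defs
begin

section \<open>Abel integrals: composition, continuity and special values\<close>

text \<open>This is J_p g. The open interval keeps both end points out of the integrand, so the
  convention \<open>0 powr _ = 0\<close> never enters and the kernel with p = 0 is constantly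
  1.\<close>

definition abel_int :: "real \<Rightarrow> real \<Rightarrow> (real \<Rightarrow> real) \<Rightarrow> real \<Rightarrow> real" where
  "abel_int a p g t = (LBINT \<tau>:{a<..<t}. g \<tau> * (t - \<tau>) powr - p)"

text \<open>The substitution \<tau> = \<sigma> + (s - \<sigma>) u carries this integral to Euler's
  Beta integral over (0,1). The Bochner form yields integrability together with the value.\<close>

lemma has_bochner_integral_Beta:
  fixes p q \<sigma> s :: real
  assumes p: "p < 1" and q: "q < 1" and "\<sigma> < s"
  shows "has_bochner_integral lborel
    (\<lambda>\<tau>. indicator {\<sigma><..<s} \<tau> * ((\<tau> - \<sigma>) powr - p * (s - \<tau>) powr - q))
    (Beta (1 - p) (1 - q) * (s - \<sigma>) powr (1 - p - q))"
proof -
  let ?d = "s - \<sigma>"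
  have B: "Beta (1 - p) (1 - q) \<ge> 0"
    using p q by (simp add: Beta_def Gamma_real_nonneg)
  have "((\<lambda>t. t powr - p * (1 - t) powr - q) has_integral Beta (1 - p) (1 - q)) {0<..<1}"
    using has_integral_Beta_real[of "1 - p" "1 - q"] p q by (simp add: has_integral_Icc_iff_Ioo)
  from nn_integral_has_integral_lebesgue[OF _ this]
  have unit: "has_bochner_integral lborel
      (\<lambda>u. indicator {0<..<1} u * (u powr - p * (1 - u) powr - q)) (Beta (1 - p) (1 - q))"
    by (intro has_bochner_integral_nn_integral) (auto simp: B)
  have eq: "indicator {\<sigma><..<s} (\<sigma> + ?d * u) *
      ((\<sigma> + ?d * u - \<sigma>) powr - p * (s - (\<sigma> + ?d * u)) powr - q) =
      ?d powr (- p - q) * (indicator {0<..<1} u * (u powr - p * (1 - u) powr - q))" for u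
  proof (cases "u \<in> {0<..<1}")
    case True
    have *: "\<sigma> + ?d * u - \<sigma> = ?d * u" "s - (\<sigma> + ?d * u) = ?d * (1 - u)"
      by (simp_all add: algebra_simps)
    have "0 < ?d * u" "0 < ?d * (1 - u)"
      using True \<open>\<sigma> < s\<close> by (auto intro!: mult_pos_pos)
    then have "\<sigma> + ?d * u \<in> {\<sigma><..<s}"
      using * by auto
    then show ?thesis
      using True \<open>\<sigma> < s\<close>
      by (simp only: * powr_mult) (simp add: powr_diff powr_minus field_simps powr_mult)
  next
    case False
    have "\<sigma> + ?d * u \<notin> {\<sigma><..<s}"
    proof
      assume "\<sigma> + ?d * u \<in> {\<sigma><..<s}"
      then have "0 < ?d * u" "?d * u < ?d"
        unfolding greaterThanLessThan_iff by linarith+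
      then show False
        using False \<open>\<sigma> < s\<close> mult_less_cancel_left_pos[of ?d u 1] by (simp add: zero_less_mult_iff)
    qed
    then show ?thesis using False by simp
  qed
  \<comment> \<open>The exponents - p and - q contribute (s - \<sigma>)^(- p - q), and the Jacobian
    supplies the one missing factor s - \<sigma>.\<close>
  have val: "Beta (1 - p) (1 - q) * ?d powr (1 - p - q) /\<^sub>R \<bar>?d\<bar> =
      ?d powr (- p - q) * Beta (1 - p) (1 - q)"
  proof -
    have "?d powr (1 - p - q) = ?d powr (- p - q) * ?d"
      using \<open>\<sigma> < s\<close> powr_add[of ?d "- p - q" 1] by (simp add: algebra_simps)
    then show ?thesis
      using \<open>\<sigma> < s\<close> by simp
  qed
  have "?d \<noteq> 0"
    using \<open>\<sigma> < s\<close> by simp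
  show ?thesis
    by (subst lborel_has_bochner_integral_real_affine_iff[OF \<open>?d \<noteq> 0\<close>, where t = \<sigma>], unfold eq val)
      (intro has_bochner_integral_mult_right unit)
qed

lemma powr_kernel_integrable:
  fixes q a s :: real
  assumes "q < 1"
  shows "integrable lborel (\<lambda>\<tau>. indicator {a<..<s} \<tau> * (s - \<tau>) powr - q)"
    (is "integrable _ ?f")
proof (cases "a < s")
  case True
  have "(\<lambda>\<tau>. indicator {a<..<s} \<tau> * ((\<tau> - a) powr - 0 * (s - \<tau>) powr - q)) = ?f"
    by (auto simp: indicator_def)
  then show ?thesis
    using has_bochner_integral_Beta[of 0 q a s] assms True by (simp add: has_bochner_integral_iff)
qed auto

text \<open>Fubini on the triangle a < \<sigma> < \<tau> < s: for fixed \<sigma> the \<tau>-integral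
  is a Beta integral, for fixed \<tau> the \<sigma>-integral is J_p g at \<tau>. The bound on g
  makes the double integral absolutely convergent.\<close>

lemma
  fixes g :: "real \<Rightarrow> real"
  assumes p: "p < 1" and q: "q < 1"
    and [measurable]: "g \<in> borel_measurable borel" and M: "\<And>t. \<bar>g t\<bar> \<le> M"
  shows set_integrable_abel_int_kernel:
      "set_integrable lborel {a<..<s} (\<lambda>\<tau>. abel_int a p g \<tau> * (s - \<tau>) powr - q)"
    and abel_int_abel_int:
      "abel_int a q (abel_int a p g) s = Beta (1 - p) (1 - q) * abel_int a (p + q - 1) g s"
proof -
  define B where "B = Beta (1 - p) (1 - q)"
  define F where "F = (\<lambda>\<sigma> \<tau>. indicator {a<..<s} \<sigma> * g \<sigma> *
     (indicator {\<sigma><..<s} \<tau> * ((\<tau> - \<sigma>) powr - p * (s - \<tau>) powr - q)))"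
  have F_meas: "case_prod F \<in> borel_measurable (lborel \<Otimes>\<^sub>M lborel)"
  proof -
    \<comment> \<open>The interval moves with \<sigma>, so its indicator is treated as that of one
      fixed set of pairs.\<close>
    have [measurable]: "Measurable.pred (lborel \<Otimes>\<^sub>M lborel) (\<lambda>x. snd x \<in> {fst x<..<s::real})"
      unfolding greaterThanLessThan_iff by measurable
    have "(\<lambda>x. indicator {fst x<..<s} (snd x) :: real) = indicator {x. snd x \<in> {fst x<..<s}}"
      by (auto simp: indicator_def)
    then have [measurable]: "(\<lambda>x. indicator {fst x<..<s} (snd x) :: real) \<in> borel_measurable (lborel \<Otimes>\<^sub>M lborel)"
      by auto
    show ?thesis
      unfolding F_def case_prod_beta by measurable
  qed
  have F_int: "has_bochner_integral lborel (F \<sigma>) (indicator {a<..<s} \<sigma> * g \<sigma> * (B * (s - \<sigma>) powr (1 - p - q)))" for \<sigma>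
  proof (cases "\<sigma> < s")
    case True
    show ?thesis
      unfolding F_def B_def
      by (intro has_bochner_integral_mult_right has_bochner_integral_Beta p q True)
  qed (auto simp: F_def)
  have F_norm: "(\<integral>\<tau>. norm (F \<sigma> \<tau>) \<partial>lborel) = indicator {a<..<s} \<sigma> * \<bar>g \<sigma>\<bar> * (B * (s - \<sigma>) powr (1 - p - q))" for \<sigma>
  proof (cases "\<sigma> < s")
    case True
    have "(\<lambda>\<tau>. norm (F \<sigma> \<tau>)) = (\<lambda>\<tau>. indicator {a<..<s} \<sigma> * \<bar>g \<sigma>\<bar> *
     (indicator {\<sigma><..<s} \<tau> * ((\<tau> - \<sigma>) powr - p * (s - \<tau>) powr - q)))"
      by (auto simp: F_def abs_mult)
    moreover have "has_bochner_integral lborel \<dots> (indicator {a<..<s} \<sigma> * \<bar>g \<sigma>\<bar> * (B * (s - \<sigma>) powr (1 - p - q)))"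
      unfolding B_def
      by (intro has_bochner_integral_mult_right has_bochner_integral_Beta p q True)
    ultimately show ?thesis by (metis has_bochner_integral_integral_eq)
  qed (auto simp: F_def)
  \<comment> \<open>From p < 1 and q < 1 follows p + q - 1 < 1, so the kernel left after the inner
    integration is integrable again.\<close>
  have "integrable lborel (\<lambda>\<sigma>. M * B * (indicator {a<..<s} \<sigma> * (s - \<sigma>) powr - (p + q - 1)))"
    using p q by (intro integrable_mult_right powr_kernel_integrable) auto
  then have outer: "integrable lborel (\<lambda>\<sigma>. \<integral>\<tau>. norm (F \<sigma> \<tau>) \<partial>lborel)"
  proof (rule Bochner_Integration.integrable_bound)
    have "\<bar>g \<sigma>\<bar> \<le> \<bar>M\<bar>" for \<sigma>
      using M[of \<sigma>] by linarith
    then show "AE \<sigma> in lborel. norm (\<integral>\<tau>. norm (F \<sigma> \<tau>) \<partial>lborel) \<le>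
        norm (M * B * (indicator {a<..<s} \<sigma> * (s - \<sigma>) powr - (p + q - 1)))"
      unfolding F_norm by (intro AE_I2) (auto simp: abs_mult indicator_def algebra_simps intro!: mult_left_mono mult_right_mono)
  qed (unfold F_norm, measurable)
  have Fub: "integrable (lborel \<Otimes>\<^sub>M lborel) (case_prod F)"
    using F_meas outer F_int
    by (intro lborel_pair.Fubini_integrable) (auto simp: has_bochner_integral_iff)
  have inner: "(\<integral>\<sigma>. F \<sigma> \<tau> \<partial>lborel) = indicator {a<..<s} \<tau> * (abel_int a p g \<tau> * (s - \<tau>) powr - q)" for \<tau>
  proof -
    \<comment> \<open>The same triangle sliced the other way: \<tau> ranges over (a,s) and \<sigma>
      over (a,\<tau>).\<close>
    have "F \<sigma> \<tau> = (indicator {a<..<s} \<tau> * (s - \<tau>) powr - q) * (indicator {a<..<\<tau>} \<sigma> * (g \<sigma> * (\<tau> - \<sigma>) powr - p))" for \<sigma>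
      by (auto simp: F_def indicator_def)
    then have "(\<integral>\<sigma>. F \<sigma> \<tau> \<partial>lborel) = (\<integral>\<sigma>. (indicator {a<..<s} \<tau> * (s - \<tau>) powr - q) * (indicator {a<..<\<tau>} \<sigma> * (g \<sigma> * (\<tau> - \<sigma>) powr - p)) \<partial>lborel)"
      by simp
    also have "\<dots> = (indicator {a<..<s} \<tau> * (s - \<tau>) powr - q) * abel_int a p g \<tau>"
      unfolding abel_int_def set_lebesgue_integral_def real_scaleR_def
      by (rule integral_mult_right_zero)
    finally show ?thesis by simp
  qed
  show "set_integrable lborel {a<..<s} (\<lambda>\<tau>. abel_int a p g \<tau> * (s - \<tau>) powr - q)"
    using lborel_pair.integrable_snd[OF Fub] by (simp add: inner set_integrable_def)
  have "abel_int a q (abel_int a p g) s = (\<integral>\<tau>. (\<integral>\<sigma>. F \<sigma> \<tau> \<partial>lborel) \<partial>lborel)"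
    by (simp add: inner abel_int_def[of a q] set_lebesgue_integral_def)
  also have "\<dots> = (\<integral>\<sigma>. (\<integral>\<tau>. F \<sigma> \<tau> \<partial>lborel) \<partial>lborel)"
    by (rule lborel_pair.Fubini_integral[OF Fub])
  also have "\<dots> = (\<integral>\<sigma>. B * (indicator {a<..<s} \<sigma> * (g \<sigma> * (s - \<sigma>) powr (1 - p - q))) \<partial>lborel)"
    by (simp only: has_bochner_integral_integral_eq[OF F_int]) (simp only: mult_ac)
  also have "\<dots> = B * abel_int a (p + q - 1) g s"
    unfolding abel_int_def set_lebesgue_integral_def
    by (subst integral_mult_right_zero) (simp add: algebra_simps)
  finally show "abel_int a q (abel_int a p g) s = Beta (1 - p) (1 - q) * abel_int a (p + q - 1) g s"
    by (simp add: B_def)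
qed

text \<open>Dominated convergence along sequences. Continuity of J_p g is what later allows its
  primitive to be differentiated at every point.\<close>

lemma continuous_on_abel_int:
  fixes g :: "real \<Rightarrow> real"
  assumes p: "p < 1" and g: "continuous_on UNIV g" and M: "\<And>t. \<bar>g t\<bar> \<le> M"
  shows "continuous_on {a..b} (abel_int a p g)"
  unfolding continuous_on_sequentially
proof (intro allI ballI impI, elim conjE)
  fix X :: "nat \<Rightarrow> real" and t
  assume t: "t \<in> {a..b}" and X: "\<forall>n. X n \<in> {a..b}" "X \<longlonglongrightarrow> t"
  \<comment> \<open>The substitution \<open>u = t - \<tau>\<close> makes the singular factor independent of \<open>t\<close>.\<close>
  define F where "F = (\<lambda>t u. indicator {0<..<t - a} u * (g (t - u) * u powr - p))"
  have [measurable]: "g \<in> borel_measurable borel"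
    using g by (rule borel_measurable_continuous_onI)
  have F_eq: "abel_int a p g t = integral\<^sup>L lborel (F t)" for t
    unfolding abel_int_def set_lebesgue_integral_def F_def
    by (subst lborel_integral_real_affine[where c = "-1" and t = t])
      (auto intro!: Bochner_Integration.integral_cong simp: indicator_def)
  \<comment> \<open>One majorant serves every term of the sequence: g is bounded by M and all
    intervals lie in (0, b - a).\<close>
  have dom: "integrable lborel (\<lambda>u. M * (indicator {0<..<b - a} u * u powr - p))"
  proof (rule integrable_mult_right, cases "0 < b - a")
    case True
    have "(\<lambda>\<tau>. indicator {0<..<b - a} \<tau> * ((\<tau> - 0) powr - p * (b - a - \<tau>) powr - 0)) =
        (\<lambda>u. indicator {0<..<b - a} u * u powr - p)"
      by (auto simp: indicator_def)
    then show "integrable lborel (\<lambda>u. indicator {0<..<b - a} u * u powr - p)"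
      using has_bochner_integral_Beta[of p 0 0 "b - a"] p True by (simp add: has_bochner_integral_iff)
  qed auto
  have "(\<lambda>n. integral\<^sup>L lborel (F (X n))) \<longlonglongrightarrow> integral\<^sup>L lborel (F t)"
  proof (rule integral_dominated_convergence[OF _ _ dom])
    show "F t \<in> borel_measurable lborel" "\<And>n. F (X n) \<in> borel_measurable lborel"
      unfolding F_def by measurable
    \<comment> \<open>At u = t - a the indicators may fail to converge; this single point is a null
      set.\<close>
    have pointwise: "(\<lambda>n. F (X n) u) \<longlonglongrightarrow> F t u" if "u \<noteq> t - a" for u
    proof -
      have Xa: "(\<lambda>n. X n - a) \<longlonglongrightarrow> t - a"
        by (intro tendsto_intros X)
      have "\<forall>\<^sub>F n in sequentially. indicator {0<..<X n - a} u = (indicator {0<..<t - a} u :: real)"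
      proof (cases "u < t - a")
        case True
        show ?thesis
          using order_tendstoD(1)[OF Xa True] by eventually_elim (use True in \<open>auto simp: indicator_def\<close>)
      next
        case False
        then have "t - a < u" using that by simp
        then show ?thesis
          using order_tendstoD(2)[OF Xa \<open>t - a < u\<close>]
          by (auto elim!: eventually_mono simp: indicator_def)
      qed
      then have ind: "(\<lambda>n. indicator {0<..<X n - a} u :: real) \<longlonglongrightarrow> indicator {0<..<t - a} u"
        by (rule tendsto_eventually)
      have "isCont g (t - u)"
        using g by (simp add: continuous_on_eq_continuous_at)
      then have "(\<lambda>n. g (X n - u)) \<longlonglongrightarrow> g (t - u)"
        by (rule isCont_tendsto_compose) (intro tendsto_intros X)
      then show ?thesis
        unfolding F_def by (intro tendsto_intros ind)
    qed
    show "AE u in lborel. (\<lambda>n. F (X n) u) \<longlonglongrightarrow> F t u"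
      using AE_lborel_singleton[of "t - a"] by eventually_elim (rule pointwise)
    have M0: "0 \<le> M" using M[of 0] by linarith
    have "norm (F (X n) u) \<le> M * (indicator {0<..<b - a} u * u powr - p)" for n u
    proof -
      have "X n - a \<le> b - a" using X by auto
      then show ?thesis
        using M[of "X n - u"] M0 by (auto simp: F_def indicator_def abs_mult intro!: mult_right_mono)
    qed
    then show "AE u in lborel. norm (F (X n) u) \<le> M * (indicator {0<..<b - a} u * u powr - p)" for n
      by simp
  qed
  then show "(abel_int a p g \<circ> X) \<longlonglongrightarrow> abel_int a p g t"
    by (simp add: F_eq o_def)
qed

text \<open>Passes to the gauge integral, for which the fundamental theorem of calculus is
  available.\<close>

lemma abel_int_0:
  assumes h: "continuous_on {a..b} h" and t: "t \<in> {a..b}"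
  shows "abel_int a 0 h t = integral {a..t} h"
proof -
  have "set_integrable lborel {a..t} h"
    using h t by (intro borel_integrable_atLeastAtMost') (auto elim: continuous_on_subset)
  then have int: "set_integrable lborel {a<..<t} h"
    by (rule set_integrable_subset) auto
  have "abel_int a 0 h t = (LBINT \<tau>:{a<..<t}. h \<tau>)"
    unfolding abel_int_def by (rule set_lebesgue_integral_cong) auto
  also have "\<dots> = integral {a..t} h"
    using set_borel_integral_eq_integral(2)[OF int] by (simp add: integral_open_interval_real)
  finally show ?thesis .
qed

lemma abel_int_const:
  assumes "p < 1" "a \<le> t"
  shows "abel_int a p (\<lambda>_. k) t = k * ((t - a) powr (1 - p) / (1 - p))"
proof (cases "a < t")
  case True
  have "abel_int a p (\<lambda>_. k) t =
      (LBINT \<tau>. k * (indicator {a<..<t} \<tau> * ((\<tau> - a) powr - 0 * (t - \<tau>) powr - p)))"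
    unfolding abel_int_def set_lebesgue_integral_def
    by (rule Bochner_Integration.integral_cong) (auto simp: indicator_def)
  also have "\<dots> = k * (Beta 1 (1 - p) * (t - a) powr (1 - p))"
    using has_bochner_integral_Beta[of 0 p a t] assms True
    by (subst integral_mult_right_zero) (simp add: has_bochner_integral_integral_eq)
  also have "Beta 1 (1 - p) = 1 / (1 - p)"
  proof -
    have "1 - p \<notin> \<int>\<^sub>\<le>\<^sub>0"
      using assms nonpos_Ints_nonpos[of "1 - p"] by auto
    then have "Gamma (1 + (1 - p)) = (1 - p) * Gamma (1 - p)"
      by (subst add.commute) (rule Gamma_plus1)
    moreover have "Gamma (1 - p) > 0"
      using assms by (simp add: Gamma_real_pos)
    ultimately show ?thesis
      by (simp add: Beta_def)
  qed
  finally show ?thesis by simp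
\<comment> \<open>For t = a the interval is empty, and the right-hand side vanishes because
  \<open>0 powr _ = 0\<close>.\<close>
qed (use assms in \<open>auto simp: abel_int_def set_lebesgue_integral_def\<close>)

section \<open>From Riemann-Liouville kernel integrals to Abel integrals\<close>

text \<open>Agreement on the open interval suffices because end points have measure zero. This
  matters for \<phi> = D^\<alpha> x, whose formula is available only to the right of a.\<close>

lemma RL_kernel_integral_eq_abel_int:
  assumes int: "set_integrable lborel {a<..<t} (\<lambda>\<tau>. h \<tau> * (t - \<tau>) powr - p)"
    and eq: "\<And>\<tau>. a < \<tau> \<Longrightarrow> \<tau> < t \<Longrightarrow> \<phi> \<tau> = h \<tau>"
  shows "set_integrable lebesgue {a..t} (\<lambda>\<tau>. \<phi> \<tau> * (t - \<tau>) powr - p)"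
    and "RL_kernel_integral a p \<phi> t = abel_int a p h t"
proof -
  let ?f = "\<lambda>\<tau>. indicator {a..t} \<tau> * (\<phi> \<tau> * (t - \<tau>) powr - p)"
  let ?h = "\<lambda>\<tau>. indicator {a<..<t} \<tau> * (h \<tau> * (t - \<tau>) powr - p)"
  \<comment> \<open>The integrands may differ at \<open>a\<close>, but not at \<open>t\<close>, because \<open>0 powr _ = 0\<close>.\<close>
  have split: "?f \<tau> = ?h \<tau> + ?f a * indicator {a} \<tau>" for \<tau>
    using eq[of \<tau>] by (auto simp: indicator_def)
  have null: "has_bochner_integral lborel (\<lambda>\<tau>. ?f a * indicator {a} \<tau>) (?f a * 0)"
    using has_bochner_integral_real_indicator[of "{a}" lborel]
    by (intro has_bochner_integral_mult_right) simp
  have "has_bochner_integral lborel ?h (abel_int a p h t)"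
    using int by (simp add: set_integrable_def abel_int_def set_lebesgue_integral_def has_bochner_integral_iff)
  from has_bochner_integral_add[OF this null]
  have *: "has_bochner_integral lborel ?f (abel_int a p h t)"
    by (subst split) simp
  then have **: "has_bochner_integral lebesgue ?f (abel_int a p h t)"
    by (auto simp: has_bochner_integral_iff integrable_completion integral_completion)
  show "set_integrable lebesgue {a..t} (\<lambda>\<tau>. \<phi> \<tau> * (t - \<tau>) powr - p)"
    and "RL_kernel_integral a p \<phi> t = abel_int a p h t"
    using ** by (auto simp: RL_kernel_integral_def set_integrable_def set_lebesgue_integral_def has_bochner_integral_iff)
qed

section \<open>Riemann-Liouville derivatives of C^1 functions\<close>

lemma dt_eq:
  assumes "a < b" "t \<in> {a..b}" "(f has_vector_derivative f') (at t within {a..b})"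
  shows "dt a b f t = f'"
  unfolding dt_def by (rule vector_derivative_within_closed_interval[OF assms])

lemma C1_on_has_vector_derivative:
  assumes "C1_on a b x" "t \<in> {a..b}"
  shows "(x has_vector_derivative dt a b x t) (at t within {a..b})"
  using assms by (simp add: C1_on_def dt_def vector_derivative_works)

text \<open>Puts x into the form on which the Abel integral lemmas act: they ask for a density that
  is bounded, and measurable or continuous, on the whole line.\<close>

lemma C1_on_primitive:
  assumes ab: "a < b" and x: "C1_on a b x"
  obtains g M where "continuous_on UNIV g" "\<And>t. \<bar>g t\<bar> \<le> M"
    "\<And>t. t \<in> {a..b} \<Longrightarrow> x t = x a + abel_int a 0 g t"
proof -
  \<comment> \<open>clamping the argument extends \<^term>\<open>dt a b x\<close> to a bounded continuous function on the line\<close>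
  define g where "g = (\<lambda>t. dt a b x (max a (min b t)))"
  have cont: "continuous_on {a..b} (dt a b x)"
    using x by (simp add: C1_on_def)
  have g: "continuous_on UNIV g"
    unfolding g_def by (rule continuous_on_compose2[OF cont]) (use ab in \<open>auto intro!: continuous_intros\<close>)
  have "bounded (dt a b x ` {a..b})"
    by (rule compact_imp_bounded[OF compact_continuous_image[OF cont compact_Icc]])
  then obtain M where "\<forall>y \<in> dt a b x ` {a..b}. norm y \<le> M"
    unfolding bounded_iff by blast
  then have M: "\<bar>g t\<bar> \<le> M" for t
    using ab by (auto simp: g_def)
  have "x t = x a + abel_int a 0 g t" if t: "t \<in> {a..b}" for t
  proof -
    have "(g has_integral x t - x a) {a..t}"
    proof (rule fundamental_theorem_of_calculus)
      fix \<tau> assume \<tau>: "\<tau> \<in> {a..t}"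
      then have "(x has_vector_derivative dt a b x \<tau>) (at \<tau> within {a..b})"
        using t x by (intro C1_on_has_vector_derivative) auto
      moreover have "g \<tau> = dt a b x \<tau>"
        using \<tau> t by (simp add: g_def)
      ultimately show "(x has_vector_derivative g \<tau>) (at \<tau> within {a..t})"
        using t by (auto intro: has_vector_derivative_within_subset)
    qed (use t in simp)
    then show ?thesis
      using abel_int_0[OF continuous_on_subset[OF g subset_UNIV] t] by (simp add: integral_unique)
  qed
  then show thesis using that g M by blast
qed

text \<open>The kernel integral of x is x(a) (t - a)^(1-p) / (1-p) plus a primitive of the
  continuous function J_p g. The point t = a is left out of the derivative since the power has
  infinite slope there.\<close>

lemma
  fixes g x :: "real \<Rightarrow> real"
  assumes ab: "a < b" and p: "0 < p" "p < 1"
    and g: "continuous_on UNIV g" "\<And>t. \<bar>g t\<bar> \<le> M"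
    and x: "\<And>t. t \<in> {a..b} \<Longrightarrow> x t = x a + abel_int a 0 g t"
  shows set_integrable_RL_kernel_C1:
      "t \<in> {a..b} \<Longrightarrow> set_integrable lebesgue {a..t} (\<lambda>\<tau>. x \<tau> * (t - \<tau>) powr - p)"
    and has_vector_derivative_RL_kernel_C1:
      "t \<in> {a<..b} \<Longrightarrow> (RL_kernel_integral a p x has_vector_derivative
         x a * (t - a) powr - p + abel_int a p g t) (at t within {a..b})"
proof -
  have gm: "g \<in> borel_measurable borel"
    using g(1) by (rule borel_measurable_continuous_onI)
  let ?h = "\<lambda>\<tau>. x a + abel_int a 0 g \<tau>"
  have int0: "set_integrable lborel {a<..<t} (\<lambda>\<tau>. abel_int a 0 g \<tau> * (t - \<tau>) powr - p)" for t
    using p by (intro set_integrable_abel_int_kernel[OF _ _ gm g(2)]) auto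
  have int1: "set_integrable lborel {a<..<t} (\<lambda>\<tau>. x a * (t - \<tau>) powr - p)" for t
    using powr_kernel_integrable[of p a t] p
    by (auto simp: set_integrable_def mult.left_commute intro!: integrable_mult_right)
  have int: "set_integrable lborel {a<..<t} (\<lambda>\<tau>. ?h \<tau> * (t - \<tau>) powr - p)" for t
    using set_integral_add(1)[OF int1 int0] by (simp add: algebra_simps)
  show "set_integrable lebesgue {a..t} (\<lambda>\<tau>. x \<tau> * (t - \<tau>) powr - p)" if "t \<in> {a..b}"
    using that by (intro RL_kernel_integral_eq_abel_int(1)[OF int] x) auto
  have cont: "continuous_on {a..b} (abel_int a p g)"
    by (rule continuous_on_abel_int[OF p(2) g])
  have K: "RL_kernel_integral a p x t =
      x a * ((t - a) powr (1 - p) / (1 - p)) + integral {a..t} (abel_int a p g)"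
    if t: "t \<in> {a..b}" for t
  proof -
    have "RL_kernel_integral a p x t = abel_int a p ?h t"
      using t by (intro RL_kernel_integral_eq_abel_int(2)[OF int] x) auto
    also have "\<dots> = abel_int a p (\<lambda>_. x a) t + abel_int a p (abel_int a 0 g) t"
      unfolding abel_int_def[of a p] using set_integral_add(2)[OF int1 int0]
      by (simp add: distrib_right)
    \<comment> \<open>Both orders give J_(p-1) g, with the factors B(1, 1-p) and B(1-p, 1), which
      agree by symmetry.\<close>
    also have "abel_int a p (abel_int a 0 g) t = abel_int a 0 (abel_int a p g) t"
      using p abel_int_abel_int[OF _ _ gm g(2), of 0 p a t] abel_int_abel_int[OF _ _ gm g(2), of p 0 a t]
      by (simp add: Beta_commute)
    also have "\<dots> = integral {a..t} (abel_int a p g)"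
      by (rule abel_int_0[OF cont t])
    finally show ?thesis
      using t p by (simp add: abel_int_const)
  qed
  show "(RL_kernel_integral a p x has_vector_derivative
         x a * (t - a) powr - p + abel_int a p g t) (at t within {a..b})" if t: "t \<in> {a<..b}"
  proof (rule has_vector_derivative_transform[OF _ K])
    have "((\<lambda>t. (t - a) powr r / r) has_real_derivative (t - a) powr (r - 1)) (at t within {a..b})"
      if "r > 0" for r
      using t that by (auto intro!: derivative_eq_intros)
    from this[of "1 - p"] have "((\<lambda>t. (t - a) powr (1 - p) / (1 - p)) has_vector_derivative (t - a) powr - p) (at t within {a..b})"
      using p by (simp add: has_real_derivative_iff_has_vector_derivative)
    then show "((\<lambda>t. x a * ((t - a) powr (1 - p) / (1 - p)) + integral {a..t} (abel_int a p g))
        has_vector_derivative x a * (t - a) powr - p + abel_int a p g t) (at t within {a..b})"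
      using integral_has_vector_derivative[OF cont, of t] t
      by (intro has_vector_derivative_add has_vector_derivative_mult_right) auto
  qed (use t in auto)
qed

lemma RL_differentiable_C1:
  assumes ab: "a < b" and \<alpha>: "\<alpha> \<in> {0..1}" and x: "C1_on a b x" and t: "t \<in> {a<..b}"
  shows "RL_differentiable a b \<alpha> x t"
proof (cases "\<alpha> \<in> {0<..<1}")
  case True
  obtain g M where g: "continuous_on UNIV g" "\<And>t. \<bar>g t\<bar> \<le> M"
    "\<And>t. t \<in> {a..b} \<Longrightarrow> x t = x a + abel_int a 0 g t"
    using C1_on_primitive[OF ab x] by metis
  show ?thesis
    using True has_vector_derivative_RL_kernel_C1[OF ab _ _ g t, of \<alpha>]
      set_integrable_RL_kernel_C1[OF ab _ _ g, of \<alpha>]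
    by (auto simp: RL_differentiable_def differentiableI_vector)
next
  case False
  then show ?thesis
    using \<alpha> x t by (auto simp: RL_differentiable_def C1_on_def)
qed

section \<open>Composition of derivatives of complementary orders\<close>

text \<open>The factor k makes room for the c/2 in the Lagrangian. The value needs a < s: at s = a
  the integral is 0, while x(a) is arbitrary.\<close>

lemma
  assumes ab: "a < b" and \<alpha>: "0 < \<alpha>" "\<alpha> < 1" and x: "C1_on a b x" and s: "s \<in> {a..b}"
  shows set_integrable_RL_kernel_RL_deriv:
      "set_integrable lebesgue {a..s} (\<lambda>\<tau>. k * RL_deriv a b \<alpha> x \<tau> * (s - \<tau>) powr - (1 - \<alpha>))"
    and RL_kernel_integral_RL_deriv:
      "a < s \<Longrightarrow> RL_kernel_integral a (1 - \<alpha>) (\<lambda>\<tau>. k * RL_deriv a b \<alpha> x \<tau>) s = k * Gamma \<alpha> * x s"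
proof -
  obtain g M where g: "continuous_on UNIV g" "\<And>t. \<bar>g t\<bar> \<le> M"
    "\<And>t. t \<in> {a..b} \<Longrightarrow> x t = x a + abel_int a 0 g t"
    using C1_on_primitive[OF ab x] by metis
  have gm: "g \<in> borel_measurable borel"
    using g(1) by (rule borel_measurable_continuous_onI)
  \<comment> \<open>Collects k and the normalising factor 1 / Gamma(1 - \<alpha>) of
    \<open>RL_deriv\<close>.\<close>
  define C where "C = k / Gamma (1 - \<alpha>)"
  define h where "h = (\<lambda>\<tau>. C * (x a * (\<tau> - a) powr - \<alpha> + abel_int a \<alpha> g \<tau>))"
  let ?w = "\<lambda>\<tau>. (s - \<tau>) powr - (1 - \<alpha>)"
  have eq: "k * RL_deriv a b \<alpha> x \<tau> = h \<tau>" if "a < \<tau>" "\<tau> < s" for \<tau>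
    using dt_eq[OF ab _ has_vector_derivative_RL_kernel_C1[OF ab \<alpha> g, of \<tau>]] that s \<alpha>
    by (simp add: RL_deriv_def h_def C_def)
  have bound: "\<alpha> < 1" "1 - \<alpha> < 1" "1 - \<alpha> > 0" using \<alpha> by auto
  have int1: "set_integrable lborel {a<..<s} (\<lambda>\<tau>. (\<tau> - a) powr - \<alpha> * ?w \<tau>)"
  proof (cases "a < s")
    case True
    then show ?thesis
      using has_bochner_integral_Beta[OF bound(1,2) True]
      by (simp add: set_integrable_def has_bochner_integral_iff)
  qed (simp add: set_integrable_def)
  note int2 = set_integrable_abel_int_kernel[OF bound(1,2) gm g(2), of a s]
  have intC: "set_integrable lborel {a<..<s}
      (\<lambda>\<tau>. x a * ((\<tau> - a) powr - \<alpha> * ?w \<tau>))"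
    using int1 by simp
  have "set_integrable lborel {a<..<s} (\<lambda>\<tau>. C * (x a * ((\<tau> - a) powr - \<alpha> * ?w \<tau>) + abel_int a \<alpha> g \<tau> * ?w \<tau>))"
    by (intro set_integrable_mult_right set_integral_add(1) intC int2)
  then have int: "set_integrable lborel {a<..<s} (\<lambda>\<tau>. h \<tau> * ?w \<tau>)"
    by (simp add: h_def algebra_simps)
  show "set_integrable lebesgue {a..s} (\<lambda>\<tau>. k * RL_deriv a b \<alpha> x \<tau> * ?w \<tau>)"
    by (rule RL_kernel_integral_eq_abel_int(1)[OF int eq])
  assume "a < s"
  have "RL_kernel_integral a (1 - \<alpha>) (\<lambda>\<tau>. k * RL_deriv a b \<alpha> x \<tau>) s = abel_int a (1 - \<alpha>) h s"
    by (rule RL_kernel_integral_eq_abel_int(2)[OF int eq])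
  also have "\<dots> = (LBINT \<tau>:{a<..<s}. C * (x a * ((\<tau> - a) powr - \<alpha> * ?w \<tau>) + abel_int a \<alpha> g \<tau> * ?w \<tau>))"
    unfolding abel_int_def[of a "1 - \<alpha>"] by (simp add: h_def algebra_simps)
  also have "\<dots> = C * (x a * (LBINT \<tau>:{a<..<s}. (\<tau> - a) powr - \<alpha> * ?w \<tau>) + abel_int a (1 - \<alpha>) (abel_int a \<alpha> g) s)"
    unfolding set_integral_mult_right set_integral_add(2)[OF intC int2] abel_int_def[of a "1 - \<alpha>"] ..
  also have "(LBINT \<tau>:{a<..<s}. (\<tau> - a) powr - \<alpha> * ?w \<tau>) = Beta (1 - \<alpha>) \<alpha>"
    using has_bochner_integral_integral_eq[OF has_bochner_integral_Beta[OF bound(1,2) \<open>a < s\<close>]] \<open>a < s\<close>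
    by (simp add: set_lebesgue_integral_def)
  also have "abel_int a (1 - \<alpha>) (abel_int a \<alpha> g) s = Beta (1 - \<alpha>) \<alpha> * abel_int a 0 g s"
    using abel_int_abel_int[OF bound(1,2) gm g(2), of a s] by simp
  also have "C * (x a * Beta (1 - \<alpha>) \<alpha> + Beta (1 - \<alpha>) \<alpha> * abel_int a 0 g s) = C * Beta (1 - \<alpha>) \<alpha> * x s"
    using g(3)[OF s] by (simp add: algebra_simps)
  \<comment> \<open>B(1-\<alpha>, \<alpha>) = Gamma(1-\<alpha>) Gamma(\<alpha>) / Gamma(1), and the
    first factor cancels the denominator of C.\<close>
  also have "C * Beta (1 - \<alpha>) \<alpha> = k * Gamma \<alpha>"
    using Gamma_real_pos[OF bound(3)] by (simp add: C_def Beta_def)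
  finally show "RL_kernel_integral a (1 - \<alpha>) (\<lambda>\<tau>. k * RL_deriv a b \<alpha> x \<tau>) s = k * Gamma \<alpha> * x s" .
qed

lemma
  assumes ab: "a < b" and \<alpha>: "\<alpha> \<in> {0..1}" and \<beta>: "\<alpha> + \<beta> = 1"
    and x: "C1_on a b x" and t: "t \<in> {a<..b}"
  shows RL_differentiable_RL_deriv: "RL_differentiable a b \<beta> (\<lambda>\<tau>. k * RL_deriv a b \<alpha> x \<tau>) t"
    and RL_deriv_RL_deriv: "RL_deriv a b \<beta> (\<lambda>\<tau>. k * RL_deriv a b \<alpha> x \<tau>) t = k * dt a b x t"
proof -
  have t': "t \<in> {a..b}" using t by auto
  note dx = C1_on_has_vector_derivative[OF x t']
  consider "\<alpha> = 0" "\<beta> = 1" | "\<alpha> = 1" "\<beta> = 0" | "0 < \<alpha>" "\<alpha> < 1" "\<beta> = 1 - \<alpha>"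
    using \<alpha> \<beta> by fastforce
  then have "RL_differentiable a b \<beta> (\<lambda>\<tau>. k * RL_deriv a b \<alpha> x \<tau>) t \<and>
      RL_deriv a b \<beta> (\<lambda>\<tau>. k * RL_deriv a b \<alpha> x \<tau>) t = k * dt a b x t"
  proof cases
    case 1
    have "((\<lambda>\<tau>. k * x \<tau>) has_vector_derivative k * dt a b x t) (at t within {a..b})"
      by (rule has_vector_derivative_mult_right[OF dx])
    from dt_eq[OF ab t' this] differentiableI_vector[OF this] show ?thesis
      using 1 by (simp add: RL_differentiable_def RL_deriv_def)
  next
    case 2
    then show ?thesis by (simp add: RL_differentiable_def RL_deriv_def)
  next
    case 3
    let ?K = "RL_kernel_integral a \<beta> (\<lambda>\<tau>. k * RL_deriv a b \<alpha> x \<tau>)"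
    have "((\<lambda>s. k * Gamma \<alpha> * x s) has_vector_derivative k * Gamma \<alpha> * dt a b x t) (at t within {a..b})"
      by (rule has_vector_derivative_mult_right[OF dx])
    then have "(?K has_vector_derivative k * Gamma \<alpha> * dt a b x t) (at t within {a..b})"
    proof (rule has_vector_derivative_transform_within)
      \<comment> \<open>The radius t - a excludes s = a, the one point of the interval where the two
        functions may differ.\<close>
      fix s assume "s \<in> {a..b}" "dist s t < t - a"
      then show "k * Gamma \<alpha> * x s = ?K s"
        using 3 RL_kernel_integral_RL_deriv[OF ab _ _ x, of \<alpha> s k] by (auto simp: dist_real_def)
    qed (use t in auto)
    note K = dt_eq[OF ab t' this] differentiableI_vector[OF this]
    have "Gamma \<alpha> \<noteq> 0"
      using Gamma_real_pos[OF \<open>0 < \<alpha>\<close>] by linarith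
    with K show ?thesis
      using 3 set_integrable_RL_kernel_RL_deriv[OF ab _ _ x, of \<alpha> _ k]
      by (simp add: RL_differentiable_def RL_deriv_def[of a b "1 - \<alpha>"])
  qed
  then show "RL_differentiable a b \<beta> (\<lambda>\<tau>. k * RL_deriv a b \<alpha> x \<tau>) t"
    and "RL_deriv a b \<beta> (\<lambda>\<tau>. k * RL_deriv a b \<alpha> x \<tau>) t = k * dt a b x t" by auto
qed

section \<open>Equivalence of the Euler-Lagrange equation and the equation of motion\<close>

theorem mainTheorem6:
  fixes a b \<alpha>1 \<alpha>2 m c :: real
    and U x :: "real \<Rightarrow> real"
    and L :: lagrangian
  assumes "a < b"
    and "\<alpha>1 \<in> {0..1}" and "\<alpha>2 \<in> {0..1}" and "\<alpha>1 + \<alpha>2 = 1"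
    and "C2_UNIV U"
    and "\<And>t y v p q. L t y v p q = 1/2 * m * v^2 - U y + 1/2 * c * (p * q)"
    and "C1_on a b x"
  shows "(\<forall>t\<in>{a<..<b}. EL_equation_at a b \<alpha>1 \<alpha>2 L x t)
     \<longleftrightarrow> (\<forall>t\<in>{a<..<b}. motion_equation_at a b m c U x t)"
proof (rule ball_cong[OF refl])
  fix t assume t: "t \<in> {a<..<b}"
  \<comment> \<open>The equivalence is shown separately at each t. Reflection maps the open interval
    to itself, so the starred terms are also evaluated away from a.\<close>
  have t': "t \<in> {a..b}" "t \<in> {a<..b}" "b - t + a \<in> {a<..b}" using t by auto
  have L: "L = (\<lambda>t y v p q. 1/2 * m * v^2 - U y + 1/2 * c * (p * q))"
    using assms(6) by blast
  have U: "(U has_field_derivative deriv U y) (at y)" for y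
    using \<open>C2_UNIV U\<close>
    by (auto simp: C2_UNIV_def C1_differentiable_on_eq real_differentiable_def
        DERIV_deriv_iff_real_differentiable)
  have p2: "partial2 L = (\<lambda>t y v p q. - deriv U y)"
    unfolding partial2_def L by (intro ext DERIV_imp_deriv) (auto intro!: derivative_eq_intros U)
  have p3: "partial3 L = (\<lambda>t y v p q. m * v)"
    unfolding partial3_def L by (intro ext DERIV_imp_deriv) (auto intro!: derivative_eq_intros)
  have p4: "partial4 L = (\<lambda>t y v p q. c / 2 * q)"
    unfolding partial4_def L by (intro ext DERIV_imp_deriv) (auto intro!: derivative_eq_intros)
  have p5: "partial5 L = (\<lambda>t y v p q. c / 2 * p)"
    unfolding partial5_def L by (intro ext DERIV_imp_deriv) (auto intro!: derivative_eq_intros)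
  let ?ev = "along a b \<alpha>1 \<alpha>2 x"
  have e2: "?ev (partial2 L) t = - deriv U (x t)"
    by (simp add: along_def p2)
  have e3: "?ev (partial3 L) = (\<lambda>t. m * dt a b x t)"
    by (simp add: along_def p3 fun_eq_iff)
  \<comment> \<open>The fourth partial derivative is c/2 times a starred function; the second star
    undoes the first.\<close>
  have e4: "dual a b (?ev (partial4 L)) = (\<lambda>t. c / 2 * RL_deriv a b \<alpha>2 x t)"
    by (simp add: along_def p4 fun_eq_iff dual_def)
  have e5: "?ev (partial5 L) = (\<lambda>t. c / 2 * RL_deriv a b \<alpha>1 x t)"
    by (simp add: along_def p5 fun_eq_iff)
  have frac: "RL_differentiable a b \<alpha>1 x t" "RL_differentiable a b \<alpha>2 x (b - t + a)"
    using assms t' by (auto intro!: RL_differentiable_C1)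
  have "\<alpha>2 + \<alpha>1 = 1" using assms by simp
  note r4 = RL_differentiable_RL_deriv[OF \<open>a < b\<close> assms(3) this assms(7) t'(3)]
    RL_deriv_RL_deriv[OF \<open>a < b\<close> assms(3) this assms(7) t'(3)]
  note r5 = RL_differentiable_RL_deriv[OF \<open>a < b\<close> assms(2,4,7) t'(3)]
    RL_deriv_RL_deriv[OF \<open>a < b\<close> assms(2,4,7) t'(3)]
  \<comment> \<open>For nonzero m one divides by m; for m = 0 the momentum m x' is constantly 0,
    hence differentiable whatever x' does.\<close>
  have diff: "?ev (partial3 L) differentiable (at t within {a..b}) \<longleftrightarrow>
      (m \<noteq> 0 \<longrightarrow> dt a b x differentiable (at t within {a..b}))"
  proof (cases "m = 0")
    case False
    have "(\<lambda>s. inverse m * (m * dt a b x s)) differentiable (at t within {a..b})"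
      if "(\<lambda>s. m * dt a b x s) differentiable (at t within {a..b})"
      using that by (rule differentiable_mult[where f = "\<lambda>_. inverse m", OF differentiable_const])
    moreover have "(\<lambda>s. inverse m * (m * dt a b x s)) = dt a b x"
      using False by (simp add: fun_eq_iff)
    moreover have "(\<lambda>s. m * dt a b x s) differentiable (at t within {a..b})"
      if "dt a b x differentiable (at t within {a..b})"
      using that by (rule differentiable_mult[where f = "\<lambda>_. m", OF differentiable_const])
    ultimately show ?thesis
      unfolding e3 using False by metis
  qed (simp add: e3)
  have d3: "dt a b (?ev (partial3 L)) t = m * dt a b (dt a b x) t"
    if "m \<noteq> 0 \<longrightarrow> dt a b x differentiable (at t within {a..b})"
  proof (cases "m = 0")
    case True
    have "((\<lambda>_. 0) has_vector_derivative (0::real)) (at t within {a..b})"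
      by (rule has_vector_derivative_const)
    from dt_eq[OF \<open>a < b\<close> t'(1) this] show ?thesis
      using True by (simp add: e3)
  next
    case False
    then have "(dt a b x has_vector_derivative dt a b (dt a b x) t) (at t within {a..b})"
      using that unfolding dt_def[of a b "dt a b x"] by (simp add: vector_derivative_works)
    from dt_eq[OF \<open>a < b\<close> t'(1) has_vector_derivative_mult_right[OF this]] show ?thesis
      by (simp add: e3)
  qed
  have "x differentiable (at t within {a..b})"
    using assms(7) t'(1) by (simp add: C1_on_def)
  \<comment> \<open>Each fractional term equals c/2 (x')^*, so together they give c (x')^*; the
    equation is then the negative of the equation of motion.\<close>
  then show "EL_equation_at a b \<alpha>1 \<alpha>2 L x t \<longleftrightarrow> motion_equation_at a b m c U x t"
    unfolding EL_equation_at_def motion_equation_at_def Let_def e2 e4 e5 diff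
    using d3 by (simp only: dual_def r4 r5 frac simp_thms) (auto simp: algebra_simps)
qed

end
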